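(* Let $\mathcal{G}=(G_n)_{n\ge1}$ be an $\mathrm{Inc}$-invariant chain of graphs with stability index $\mathrm{ind}(\mathcal{G})=r$. Assume that $V(G_r)=[r]$ and that $(1,i),(j,r)\in E(G_r)$ for some $i,j\in[r]$. Let $\ell(G_n)$ and $\ell'(G_n)$ denote the maximal lengths of an admissible path and of a minimal path in $G_n$, respectively. Then the following statements hold: (i) For every $n\ge5r$, $\ell(G_n)\le3$ and $\ell'(G_n)\le5$. (ii) For every $n\ge5r+9$, $\ell(G_n)=\ell(G_{n+1})$ and $\ell'(G_n)=\ell'(G_{n+1})$.
   Context: $\mathbb{N}$ is the set of positive integers and $[n]=\{1,\dots,n\}$. Graphs are simple and finite, with vertex set contained in $\mathbb{N}$ (possibly empty); an edge $\{i,j\}$ with $i<j$ is written $(i,j)$. $G\subseteq H$ means $V(G)\subseteq V(H)$ and $E(G)\subseteq E(H)$. $\mathrm{Inc}$ is the monoid of strictly increasing maps $\pi:\mathbb{N}\to\mathbb{N}$, and $\mathrm{Inc}_{n,m}=\{\pi\in\mathrm{Inc}\mid\pi(n)\le m\}$ for $n\le m$. For $\Gamma\subseteq\mathrm{Inc}$ and a graph $G$, $\Gamma(G)$ is the graph with vertex set $\bigcup_{\pi\in\Gamma}\pi(V(G))$ and edge set $\{(\pi(i),\pi(j))\mid \pi\in\Gamma,(i,j)\in E(G)\}$. An $\mathrm{Inc}$-invariant chain of graphs is a sequence $(G_n)_{n\ge1}$ of graphs with $V(G_n)\subseteq[n]$ and $\mathrm{Inc}_{n,m}(G_n)\subseteq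 G_m$ for all $m\ge n\ge1$. Every such chain stabilizes: there is $r\in\mathbb{N}$ with $\mathrm{Inc}_{n,m}(G_n)=G_m$ for all $m\ge n\ge r$; the smallest such $r$ is the stability index $\mathrm{ind}(\mathcal{G})$. A path of length $q\ge1$ in $G$ is a sequence of vertices $(u_0,\dots,u_q)$ with $\{u_{k-1},u_k\}\in E(G)$ for $1\le k\le q$. Let $G$ be a graph on $[n]$ and $u<v$ vertices. A path $P=(u_0,\dots,u_q)$ from $u_0=u$ to $u_q=v$ is called admissible if: (1) $u_k\ne u_l$ whenever $k\ne l$; (2) for every proper subset $\{v_1,\dots,v_t\}\subsetneq\{u_1,\dots,u_{q-1}\}$ (in any ordering, including the empty subset when proper), the sequence $u,v_1,\dots,v_t,v$ is not a path in $G$; (3) every internal vertex $u_k$, $1\le k\le q-1$, satisfies $u_k<u$ or $u_k>v$. A path (from $u$ to $v$ with $u<v$) satisfying only (1) and (2) is called minimal. *)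

theory Defs
  imports Main
begin

text \<open>The positive integers are modelled inside the type \<open>nat\<close>; \<open>0\<close> is never a vertex.  An edge is a
  two-element set, so that \<open>(i,j)\<close> with \<open>i < j\<close> in the usual notation is \<open>{i,j}\<close> here.\<close>

record ugraph =
  verts :: "nat set"
  edges :: "nat set set"

definition is_graph :: "ugraph \<Rightarrow> bool" where
  "is_graph G \<longleftrightarrow> finite (verts G) \<and> verts G \<subseteq> {1..} \<and>
     (\<forall>e\<in>edges G. e \<subseteq> verts G \<and> card e = 2)"

definition subgraph :: "ugraph \<Rightarrow> ugraph \<Rightarrow> bool" where
  "subgraph G H \<longleftrightarrow> verts G \<subseteq> verts H \<and> edges G \<subseteq> edges H"

text \<open>Only the restriction of \<open>\<pi>\<close> to the positive integers matters; the value at \<open>0\<close> is left free.\<close>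

definition Inc :: "(nat \<Rightarrow> nat) set" where
  "Inc = {\<pi>. strict_mono_on {1..} \<pi> \<and> \<pi> ` {1..} \<subseteq> {1..}}"

definition Inc_upto :: "nat \<Rightarrow> nat \<Rightarrow> (nat \<Rightarrow> nat) set" where
  "Inc_upto n m = {\<pi> \<in> Inc. \<pi> n \<le> m}"

definition graph_image :: "(nat \<Rightarrow> nat) set \<Rightarrow> ugraph \<Rightarrow> ugraph" where
  "graph_image \<Gamma> G =
     \<lparr> verts = (\<Union>\<pi>\<in>\<Gamma>. \<pi> ` verts G),
       edges = {{\<pi> i, \<pi> j} | \<pi> i j. \<pi> \<in> \<Gamma> \<and> {i, j} \<in> edges G} \<rparr>"

text \<open>Chains are indexed by the positive integers; the value at index \<open>0\<close> is irrelevant.\<close>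

definition inc_invariant_chain :: "(nat \<Rightarrow> ugraph) \<Rightarrow> bool" where
  "inc_invariant_chain \<G> \<longleftrightarrow>
     (\<forall>n\<ge>1. is_graph (\<G> n) \<and> verts (\<G> n) \<subseteq> {1..n}) \<and>
     (\<forall>n\<ge>1. \<forall>m\<ge>n. subgraph (graph_image (Inc_upto n m) (\<G> n)) (\<G> m))"

definition stable_from :: "(nat \<Rightarrow> ugraph) \<Rightarrow> nat \<Rightarrow> bool" where
  "stable_from \<G> r \<longleftrightarrow> (\<forall>n\<ge>r. \<forall>m\<ge>n. graph_image (Inc_upto n m) (\<G> n) = \<G> m)"

text \<open>Every \<open>Inc\<close>-invariant chain stabilizes (by Dickson's lemma), so the minimum exists for such chains.\<close>

definition stability_index :: "(nat \<Rightarrow> ugraph) \<Rightarrow> nat" where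
  "stability_index \<G> = (LEAST r. r \<ge> 1 \<and> stable_from \<G> r)"

text \<open>The path \<open>(u\<^sub>0, \<dots>, u\<^sub>q)\<close> is the list \<open>[u\<^sub>0, \<dots>, u\<^sub>q]\<close>; its length in the graph-theoretic sense is
  \<open>q\<close>, one less than the length of the list.\<close>

definition is_path :: "ugraph \<Rightarrow> nat list \<Rightarrow> bool" where
  "is_path G us \<longleftrightarrow> length us \<ge> 2 \<and> set us \<subseteq> verts G \<and>
     (\<forall>k. Suc k < length us \<longrightarrow> {us ! k, us ! Suc k} \<in> edges G)"

definition path_length :: "nat list \<Rightarrow> nat" where
  "path_length us = length us - 1"

definition internal_vertices :: "nat list \<Rightarrow> nat set" where
  "internal_vertices us = set (butlast (tl us))"

definition minimal_path :: "ugraph \<Rightarrow> nat list \<Rightarrow> bool" where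
  "minimal_path G us \<longleftrightarrow>
     is_path G us \<and> hd us < last us \<and> distinct us \<and>
     (\<forall>vs. distinct vs \<and> set vs \<subset> internal_vertices us \<longrightarrow> \<not> is_path G (hd us # vs @ [last us]))"

definition admissible_path :: "ugraph \<Rightarrow> nat list \<Rightarrow> bool" where
  "admissible_path G us \<longleftrightarrow>
     minimal_path G us \<and> (\<forall>w\<in>internal_vertices us. w < hd us \<or> w > last us)"

text \<open>Both maxima range over finite sets, as the vertices of a path are distinct; the sets are non-empty
  as soon as the graph has an edge.\<close>

definition max_admissible_length :: "ugraph \<Rightarrow> nat" where
  "max_admissible_length G = Max {path_length us | us. admissible_path G us}"

definition max_minimal_length :: "ugraph \<Rightarrow> nat" where
  "max_minimal_length G = Max {path_length us | us. minimal_path G us}"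

end

theory Submission
  imports Defs
begin

text \<open>For \<open>n \<ge> r\<close> the pair \<open>a < b\<close> is an edge of \<open>G\<^sub>n\<close> iff some edge \<open>i < j\<close> of \<open>G\<^sub>r\<close> satisfies
  \<open>i \<le> a\<close>, \<open>j - i \<le> b - a\<close> and \<open>r - j \<le> n - b\<close>: three lower bounds, on the position from the left, the
  distance and the position from the right.  The edges at \<open>1\<close> and at \<open>r\<close> make two vertices at distance
  at least \<open>r\<close> adjacent, unless one is near the left end and the other near the right end.

  A minimal path is an induced path, and this adjacency has very few induced paths.  As \<open>n \<ge> 5r\<close>,
  every induced path misses a whole window of \<open>r - 1\<close> consecutive numbers
  (\<open>empty_window_exists\<close>): five such windows are disjoint, which suffices for up to four vertices, and
  in a path that meets the leftmost, the rightmost and a central window, the vertex in the central window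
  is adjacent to the other two, which leaves almost no room for more vertices.

  The window splits the path into a left and a right part.  Inside the left part the third bound always
  holds, so adjacency of \<open>a < b\<close> only improves when \<open>b\<close> grows; inside the right part the first bound
  always holds, so adjacency only improves when \<open>a\<close> decreases; across the window the distance bound
  always holds, so adjacency only improves when both vertices move towards the window.  Hence, if
  both parts are non-empty, the two path vertices next to the window are adjacent and every edge of the
  path has an endpoint in or next to this pair, which gives length at most five; if one part is empty,
  two disjoint edges are always joined, which gives length at most three.  For an admissible
  path with endpoints on different sides, the two vertices next to the window lie between the endpoints,
  so they are the endpoints; with endpoints on the same side, five vertices would force a chord
  (\<open>split_sequence.length_bounds\<close>).

  Finally, inserting or deleting one number inside the window changes none of the decisive bounds, so
  the induced paths of \<open>G\<^sub>n\<close> and of \<open>G\<^bsub>n+1\<^esub>\<close> correspond to each other in an order-preserving way, and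
  the sets of path lengths are equal.

  The stability index is a least element, so it has its defining property only because every chain
  stabilizes; that rests on Dickson's lemma for the triples of the three bounds.\<close>

section \<open>Stabilization\<close>

text \<open>For a quasi-order this says that it is a well-quasi-order.\<close>

definition finite_basis_property :: "('a \<Rightarrow> 'a \<Rightarrow> bool) \<Rightarrow> bool" where
  "finite_basis_property le \<longleftrightarrow>
     (\<forall>M. \<exists>F\<subseteq>M. finite F \<and> (\<forall>y\<in>M. \<exists>x\<in>F. le x y))"

text \<open>The induction step of Dickson's lemma.  A basis of the projection to the second component settles
  all pairs whose first component is at least some bound \<open>K\<close>; the finitely many slices below \<open>K\<close> have
  bases of their own.\<close>

lemma finite_basis_property_nat_times:
  assumes "finite_basis_property le"
  shows "finite_basis_property (\<lambda>(k::nat, x) (l, y). k \<le> l \<and> le x y)"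
  unfolding finite_basis_property_def
proof
  fix M :: "(nat \<times> 'a) set"
  have basis: "\<exists>F\<subseteq>N. finite F \<and> (\<forall>y\<in>N. \<exists>x\<in>F. le x y)" for N
    using assms unfolding finite_basis_property_def by blast
  obtain F where F: "F \<subseteq> snd ` M" "finite F" "\<And>y. y \<in> snd ` M \<Longrightarrow> \<exists>x\<in>F. le x y"
    using basis[of "snd ` M"] by meson
  have "\<exists>k. (k, x) \<in> M" if "x \<in> F" for x
    using F(1) that by force
  then obtain \<kappa> where \<kappa>: "\<And>x. x \<in> F \<Longrightarrow> (\<kappa> x, x) \<in> M" by metis
  have "\<forall>k. \<exists>B. B \<subseteq> {y. (k, y) \<in> M} \<and> finite B \<and> (\<forall>y. (k, y) \<in> M \<longrightarrow> (\<exists>x\<in>B. le x y))"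
    using basis[of "{y. (k, y) \<in> M}" for k] by simp
  then obtain B where "\<forall>k. B k \<subseteq> {y. (k, y) \<in> M} \<and> finite (B k) \<and>
      (\<forall>y. (k, y) \<in> M \<longrightarrow> (\<exists>x\<in>B k. le x y))"
    by (rule choice[THEN exE])
  then have B: "\<And>k. B k \<subseteq> {y. (k, y) \<in> M}" "\<And>k. finite (B k)"
    "\<And>k y. (k, y) \<in> M \<Longrightarrow> \<exists>x\<in>B k. le x y"
    by simp_all
  define K where "K = Max (insert 0 (\<kappa> ` F))"
  have K: "\<kappa> x \<le> K" if "x \<in> F" for x
    unfolding K_def using that F(2) by (intro Max_ge) auto
  let ?F = "(\<lambda>x. (\<kappa> x, x)) ` F \<union> (SIGMA k:{..<K}. B k)"
  have "?F \<subseteq> M" using \<kappa> B(1) by blast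
  moreover have "finite ?F" using F(2) B(2) by auto
  moreover have "\<exists>x\<in>?F. (\<lambda>(k, x) (l, y). k \<le> l \<and> le x y) x y" if "y \<in> M" for y
  proof -
    obtain l z where y: "y = (l, z)" by (cases y)
    show ?thesis
    proof (cases "l < K")
      case True
      then obtain x where "x \<in> B l" "le x z" using B(3) \<open>y \<in> M\<close> y by blast
      then have "(l, x) \<in> ?F" using True by auto
      then show ?thesis using \<open>le x z\<close> y by (intro bexI[of _ "(l, x)"]) auto
    next
      case False
      have "z \<in> snd ` M" using \<open>y \<in> M\<close> y by force
      then obtain x where "x \<in> F" "le x z" using F(3) by blast
      then show ?thesis using K[of x] False y by (intro bexI[of _ "(\<kappa> x, x)"]) auto
    qed
  qed
  ultimately show "\<exists>F\<subseteq>M. finite F \<and> (\<forall>y\<in>M. \<exists>x\<in>F. (\<lambda>(k, x) (l, y). k \<le> l \<and> le x y) x y)"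
    by (intro exI[of _ ?F] conjI ballI)
qed

lemma dickson_triples:
  fixes M :: "(nat \<times> nat \<times> nat) set"
  obtains F where "F \<subseteq> M" "finite F"
    "\<And>a d c. (a, d, c) \<in> M \<Longrightarrow> \<exists>a' d' c'. (a', d', c') \<in> F \<and> a' \<le> a \<and> d' \<le> d \<and> c' \<le> c"
proof -
  have "finite_basis_property (\<lambda>(x::nat) y. x \<le> y)"
    unfolding finite_basis_property_def
  proof
    fix M :: "nat set"
    show "\<exists>F\<subseteq>M. finite F \<and> (\<forall>y\<in>M. \<exists>x\<in>F. x \<le> y)"
    proof (cases "M = {}")
      case False
      then obtain m where "m \<in> M" by blast
      then have "(LEAST x. x \<in> M) \<in> M" by (rule LeastI)
      then show ?thesis
        by (intro exI[of _ "{LEAST x. x \<in> M}"]) (auto intro: Least_le)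
    qed auto
  qed
  then have "finite_basis_property
      (\<lambda>(k::nat, x) (l, y). k \<le> l \<and> (\<lambda>(k::nat, x::nat) (l, y). k \<le> l \<and> x \<le> y) x y)"
    by (intro finite_basis_property_nat_times)
  then have "\<exists>F\<subseteq>M. finite F \<and> (\<forall>y\<in>M. \<exists>x\<in>F.
      (\<lambda>(k, x) (l, y). k \<le> l \<and> (\<lambda>(k, x) (l, y). k \<le> l \<and> x \<le> y) x y) x y)"
    unfolding finite_basis_property_def by (rule spec)
  then obtain F where F: "F \<subseteq> M" "finite F"
    "\<forall>y\<in>M. \<exists>x\<in>F. (\<lambda>(k, x) (l, y). k \<le> l \<and> (\<lambda>(k, x) (l, y). k \<le> l \<and> x \<le> y) x y) x y"
    by (elim exE conjE) (rule that)
  show ?thesis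
  proof
    fix a d c assume "(a, d, c) \<in> M"
    from bspec[OF F(3) this] obtain x where x: "x \<in> F"
      "(\<lambda>(k, x) (l, y). k \<le> l \<and> (\<lambda>(k, x) (l, y). k \<le> l \<and> x \<le> y) x y) x (a, d, c)"
      by (rule bexE)
    obtain a' d' c' where "x = (a', d', c')" by (rule prod_cases3)
    with x show "\<exists>a' d' c'. (a', d', c') \<in> F \<and> a' \<le> a \<and> d' \<le> d \<and> c' \<le> c"
      by (intro exI[of _ a'] exI[of _ d'] exI[of _ c']) simp
  qed (fact F(1) F(2))+
qed

lemma Inc_expands:
  assumes "\<pi> \<in> Inc" "1 \<le> i" "i \<le> j"
  shows "\<pi> i + j \<le> \<pi> j + i" and "i \<le> \<pi> i"
proof -
  have step: "\<pi> k < \<pi> (Suc k)" if "1 \<le> k" for k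
    using assms(1) that unfolding Inc_def by (auto intro: strict_mono_onD)
  have exp: "\<pi> k + l \<le> \<pi> l + k" if "1 \<le> k" "k \<le> l" for k l
    using that(2,1)
  proof (induction l rule: dec_induct)
    case (step l)
    then show ?case using \<open>\<And>k. 1 \<le> k \<Longrightarrow> \<pi> k < \<pi> (Suc k)\<close>[of l] by fastforce
  qed simp
  show "\<pi> i + j \<le> \<pi> j + i" using exp assms by blast
  have "1 \<le> \<pi> 1" using assms(1) unfolding Inc_def by auto
  then show "i \<le> \<pi> i" using exp[of 1 i] assms(2) by simp
qed

text \<open>The three inequalities are also necessary, by \<open>Inc_expands\<close>.  Thus the triple \<open>(i, j - i, n - j)\<close> encodes
  a pair so that, among pairs \<open>i < j\<close> and among pairs \<open>i = j\<close>, the maps in \<open>Inc\<close> realize exactly the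
  componentwise increase of triples.\<close>

lemma Inc_upto_map_exists:
  assumes "1 \<le> i" "i \<le> j" "j \<le> n" "i \<le> a" "j + a \<le> b + i" "b + n \<le> m + j" "i = j \<Longrightarrow> a = b"
  obtains \<pi> where "\<pi> \<in> Inc_upto n m" "\<pi> i = a" "\<pi> j = b"
proof
  define \<pi> where "\<pi> = (\<lambda>x. if x < i then x else if x < j then x + (a - i) else x + (b - j))"
  have "strict_mono_on {1..} \<pi>" unfolding \<pi>_def strict_mono_on_def using assms by auto
  moreover have "\<pi> ` {1..} \<subseteq> {1..}" unfolding \<pi>_def by auto
  ultimately show "\<pi> \<in> Inc_upto n m" unfolding Inc_upto_def Inc_def
    using assms by (auto simp: \<pi>_def)
  show "\<pi> i = a" "\<pi> j = b" unfolding \<pi>_def using assms by auto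
qed

lemma interpolate_sum:
  fixes i d c :: nat
  assumes "i \<le> a" "d \<le> e" "c \<le> g" "i + d + c \<le> n" "n \<le> a + e + g"
  obtains i' d' c' where "i \<le> i'" "i' \<le> a" "d \<le> d'" "d' \<le> e" "c \<le> c'" "c' \<le> g" "i' + d' + c' = n"
proof -
  consider "n \<le> a + d + c" | "a + d + c < n" "n \<le> a + e + c" | "a + e + c < n" by linarith
  then show ?thesis
  proof cases
    case 1
    then show ?thesis using assms by (intro that[of "n - d - c" d c]) auto
  next
    case 2
    then show ?thesis using assms by (intro that[of a "n - a - c" c]) auto
  next
    case 3
    then show ?thesis using assms by (intro that[of a e "n - a - e"]) auto
  qed
qed

text \<open>Vertices (as pairs \<open>a = b\<close>) and edges (as pairs \<open>a < b\<close>) of a chain are two instances of the family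
  \<open>X\<close>.  The triples that occur have a finite basis by Dickson's lemma, and \<open>r\<close> is the largest level
  of a basis element.  An element at level \<open>m\<close> lies above a basis element at level \<open>k \<le> r\<close>, and
  interpolating between the two triples gives a preimage at each level \<open>n\<close> in between.\<close>

lemma Inc_closed_family_generated:
  fixes X :: "nat \<Rightarrow> nat \<Rightarrow> nat \<Rightarrow> bool"
  assumes range: "\<And>n a b. 1 \<le> n \<Longrightarrow> X n a b \<Longrightarrow> 1 \<le> a \<and> a \<le> b \<and> b \<le> n"
    and same: "\<And>n m a b a' b'. 1 \<le> n \<Longrightarrow> 1 \<le> m \<Longrightarrow> X n a b \<Longrightarrow> X m a' b' \<Longrightarrow> a = b \<longleftrightarrow> a' = b'"
    and closed: "\<And>n m \<pi> a b. 1 \<le> n \<Longrightarrow> n \<le> m \<Longrightarrow> \<pi> \<in> Inc_upto n m \<Longrightarrow> X n a b \<Longrightarrow> X m (\<pi> a) (\<pi> b)"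
  shows "\<exists>r. \<forall>n m a b. r \<le> n \<longrightarrow> n \<le> m \<longrightarrow> 1 \<le> m \<longrightarrow> X m a b \<longrightarrow>
    (\<exists>\<pi>\<in>Inc_upto n m. \<exists>a' b'. X n a' b' \<and> \<pi> a' = a \<and> \<pi> b' = b)"
proof -
  define M where "M = {(a, b - a, n - b) | a b n. 1 \<le> n \<and> X n a b}"
  obtain F where F: "F \<subseteq> M" "finite F"
    "\<And>a d c. (a, d, c) \<in> M \<Longrightarrow> \<exists>a' d' c'. (a', d', c') \<in> F \<and> a' \<le> a \<and> d' \<le> d \<and> c' \<le> c"
    by (rule dickson_triples[of M]) (rule that)
  define r where "r = Max (insert 0 ((\<lambda>(a, d, c). a + d + c) ` F))"
  have r: "a + d + c \<le> r" if "(a, d, c) \<in> F" for a d c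
  proof -
    have "(\<lambda>(a, d, c). a + d + c) (a, d, c) \<in> (\<lambda>(a, d, c). a + d + c) ` F"
      using that by (rule imageI)
    then show ?thesis unfolding r_def using F(2) by (intro Max_ge) auto
  qed
  show ?thesis
  proof (intro exI[of _ r] allI impI)
    fix n m a b assume nm: "r \<le> n" "n \<le> m" "1 \<le> m" and X: "X m a b"
    have ab: "1 \<le> a" "a \<le> b" "b \<le> m" using range[OF nm(3) X] by auto
    have "(a, b - a, m - b) \<in> M" unfolding M_def using nm X by blast
    then obtain i d c where idc: "(i, d, c) \<in> F" "i \<le> a" "d \<le> b - a" "c \<le> m - b"
      using F(3) by blast
    then have "(i, d, c) \<in> M" using F(1) by blast
    then obtain j k where jk: "d = j - i" "c = k - j" "1 \<le> k" "X k i j" unfolding M_def by blast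
    have ij: "1 \<le> i" "i \<le> j" "j \<le> k" using range[OF jk(3,4)] by auto
    have eq: "i = j \<longleftrightarrow> a = b" using same[OF jk(3) nm(3) jk(4) X] .
    have kr: "k \<le> r" using r[OF idc(1)] jk ij by simp
    have "i + d + c \<le> n" "n \<le> a + (b - a) + (m - b)" using jk ij kr nm ab by simp_all
    then obtain i' d' c' where new: "i \<le> i'" "i' \<le> a" "d \<le> d'" "d' \<le> b - a" "c \<le> c'" "c' \<le> m - b"
      "i' + d' + c' = n"
      using interpolate_sum[OF idc(2-4), of n] by metis
    have "i' + d' \<le> n" "j + i' \<le> (i' + d') + i" "(i' + d') + k \<le> n + j" "i = j \<Longrightarrow> i' = i' + d'"
      using new jk(1,2) ij eq by auto
    obtain \<pi> where "\<pi> \<in> Inc_upto k n" "\<pi> i = i'" "\<pi> j = i' + d'"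
      using Inc_upto_map_exists[OF ij new(1) \<open>j + i' \<le> (i' + d') + i\<close>
          \<open>(i' + d') + k \<le> n + j\<close> \<open>i = j \<Longrightarrow> i' = i' + d'\<close>] by metis
    then have "X n i' (i' + d')" using closed[OF jk(3) _ _ jk(4), of n \<pi>] kr nm(1) by simp
    moreover have "1 \<le> i'" "i' \<le> i' + d'" "(i' + d') + a \<le> b + i'" "b + n \<le> m + (i' + d')"
      "i' = i' + d' \<Longrightarrow> a = b"
      using new jk(1,2) ij eq ab by auto
    then obtain \<pi>' where "\<pi>' \<in> Inc_upto n m" "\<pi>' i' = a" "\<pi>' (i' + d') = b"
      using Inc_upto_map_exists[OF \<open>1 \<le> i'\<close> \<open>i' \<le> i' + d'\<close> \<open>i' + d' \<le> n\<close> new(2)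
          \<open>(i' + d') + a \<le> b + i'\<close> \<open>b + n \<le> m + (i' + d')\<close>] by metis
    ultimately show "\<exists>\<pi>\<in>Inc_upto n m. \<exists>a' b'. X n a' b' \<and> \<pi> a' = a \<and> \<pi> b' = b"
      by blast
  qed
qed

lemma is_graph_edge:
  assumes "is_graph G" "{a, b} \<in> edges G"
  shows "a \<in> verts G" "b \<in> verts G" "a \<noteq> b"
proof -
  have "{a, b} \<subseteq> verts G \<and> card {a, b} = 2" using assms unfolding is_graph_def by blast
  then show "a \<in> verts G" "b \<in> verts G" "a \<noteq> b" by auto
qed

lemma is_graph_edgeE:
  assumes "is_graph G" "e \<in> edges G"
  obtains a b :: nat where "e = {a, b}" "a < b" "{a, b} \<in> edges G"
proof -
  have "card e = 2" using assms unfolding is_graph_def by blast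
  then obtain a b where "e = {a, b}" "a \<noteq> b" by (auto simp: card_2_iff)
  then show ?thesis
    using that[of a b] that[of b a] assms(2) by (cases "a < b") (auto simp: insert_commute)
qed

lemma chain_stabilizes:
  assumes chain: "inc_invariant_chain \<G>"
  shows "\<exists>r\<ge>1. stable_from \<G> r"
proof -
  have graph: "is_graph (\<G> n)" "verts (\<G> n) \<subseteq> {1..n}" if "1 \<le> n" for n
    using chain that unfolding inc_invariant_chain_def by auto
  have sub: "subgraph (graph_image (Inc_upto n m) (\<G> n)) (\<G> m)" if "1 \<le> n" "n \<le> m" for n m
    using chain that unfolding inc_invariant_chain_def by auto
  have "\<exists>r. \<forall>n m a b. r \<le> n \<longrightarrow> n \<le> m \<longrightarrow> 1 \<le> m \<longrightarrow> a = b \<and> a \<in> verts (\<G> m) \<longrightarrow>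
      (\<exists>\<pi>\<in>Inc_upto n m. \<exists>a' b'. (a' = b' \<and> a' \<in> verts (\<G> n)) \<and> \<pi> a' = a \<and> \<pi> b' = b)"
  proof (rule Inc_closed_family_generated[of "\<lambda>n a b. a = b \<and> a \<in> verts (\<G> n)"])
    show "1 \<le> a \<and> a \<le> b \<and> b \<le> n" if "1 \<le> n" "a = b \<and> a \<in> verts (\<G> n)" for n a b
      using graph(2)[OF that(1)] that(2) by auto
    show "\<pi> a = \<pi> b \<and> \<pi> a \<in> verts (\<G> m)"
      if "1 \<le> n" "n \<le> m" "\<pi> \<in> Inc_upto n m" "a = b \<and> a \<in> verts (\<G> n)" for n m \<pi> a b
      using sub[OF that(1,2)] that(3,4) unfolding subgraph_def graph_image_def by auto
  qed simp
  then obtain r1 where *: "\<forall>n m a b. r1 \<le> n \<longrightarrow> n \<le> m \<longrightarrow> 1 \<le> m \<longrightarrow> a = b \<and> a \<in> verts (\<G> m) \<longrightarrow>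
      (\<exists>\<pi>\<in>Inc_upto n m. \<exists>a' b'. (a' = b' \<and> a' \<in> verts (\<G> n)) \<and> \<pi> a' = a \<and> \<pi> b' = b)"
    by (rule exE)
  have r1: "\<exists>\<pi>\<in>Inc_upto n m. \<exists>w\<in>verts (\<G> n). \<pi> w = v"
    if "r1 \<le> n" "n \<le> m" "1 \<le> m" "v \<in> verts (\<G> m)" for n m v
    using *[rule_format, of n m v v] that by blast
  have "\<exists>r. \<forall>n m a b. r \<le> n \<longrightarrow> n \<le> m \<longrightarrow> 1 \<le> m \<longrightarrow> a < b \<and> {a, b} \<in> edges (\<G> m) \<longrightarrow>
      (\<exists>\<pi>\<in>Inc_upto n m. \<exists>a' b'. (a' < b' \<and> {a', b'} \<in> edges (\<G> n)) \<and> \<pi> a' = a \<and> \<pi> b' = b)"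
  proof (rule Inc_closed_family_generated[of "\<lambda>n a b. a < b \<and> {a, b} \<in> edges (\<G> n)"])
    show "1 \<le> a \<and> a \<le> b \<and> b \<le> n" if "1 \<le> n" "a < b \<and> {a, b} \<in> edges (\<G> n)" for n a b
      using is_graph_edge[OF graph(1)[OF that(1)], of a b] graph(2)[OF that(1)] that(2) by auto
    show "\<pi> a < \<pi> b \<and> {\<pi> a, \<pi> b} \<in> edges (\<G> m)"
      if "1 \<le> n" "n \<le> m" "\<pi> \<in> Inc_upto n m" "a < b \<and> {a, b} \<in> edges (\<G> n)" for n m \<pi> a b
    proof -
      have "1 \<le> a"
        using is_graph_edge[OF graph(1)[OF that(1)], of a b] graph(2)[OF that(1)] that(4) by auto
      then have "\<pi> a < \<pi> b"
        using Inc_expands(1)[of \<pi> a b] that(3,4) unfolding Inc_upto_def by auto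
      moreover have "{\<pi> a, \<pi> b} \<in> edges (\<G> m)"
        using sub[OF that(1,2)] that(3,4) unfolding subgraph_def graph_image_def by (simp only: ugraph.simps) blast
      ultimately show ?thesis by blast
    qed
  qed simp
  then obtain r2 where **: "\<forall>n m a b. r2 \<le> n \<longrightarrow> n \<le> m \<longrightarrow> 1 \<le> m \<longrightarrow> a < b \<and> {a, b} \<in> edges (\<G> m) \<longrightarrow>
      (\<exists>\<pi>\<in>Inc_upto n m. \<exists>a' b'. (a' < b' \<and> {a', b'} \<in> edges (\<G> n)) \<and> \<pi> a' = a \<and> \<pi> b' = b)"
    by (rule exE)
  have r2: "\<exists>\<pi>\<in>Inc_upto n m. \<exists>a' b'. {a', b'} \<in> edges (\<G> n) \<and> \<pi> a' = a \<and> \<pi> b' = b"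
    if "r2 \<le> n" "n \<le> m" "1 \<le> m" "a < b" "{a, b} \<in> edges (\<G> m)" for n m a b
    using **[rule_format, of n m a b] that by blast
  have "stable_from \<G> (max 1 (max r1 r2))"
    unfolding stable_from_def
  proof (intro allI impI)
    fix n m assume n: "max 1 (max r1 r2) \<le> n" and m: "n \<le> m"
    let ?I = "graph_image (Inc_upto n m) (\<G> n)"
    have "verts (\<G> m) \<subseteq> verts ?I"
    proof
      fix v assume "v \<in> verts (\<G> m)"
      then obtain \<pi> w where "\<pi> \<in> Inc_upto n m" "w \<in> verts (\<G> n)" "\<pi> w = v"
        using r1[of n m v] n m by auto
      then show "v \<in> verts ?I" unfolding graph_image_def by auto
    qed
    moreover have "edges (\<G> m) \<subseteq> edges ?I"
    proof
      fix e assume "e \<in> edges (\<G> m)"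
      then obtain a b where ab: "e = {a, b}" "a < b" "{a, b} \<in> edges (\<G> m)"
        using is_graph_edgeE[OF graph(1)[of m], of e] n m by auto
      then obtain \<pi> a' b' where "\<pi> \<in> Inc_upto n m" "{a', b'} \<in> edges (\<G> n)" "\<pi> a' = a" "\<pi> b' = b"
        using r2[of n m a b] n m by auto
      then show "e \<in> edges ?I" using ab(1) unfolding graph_image_def by auto
    qed
    ultimately show "?I = \<G> m"
      using sub[of n m] n m unfolding subgraph_def by (intro ugraph.equality) auto
  qed
  then show ?thesis by (meson max.cobounded1)
qed

lemma stable_from_stability_index:
  assumes "inc_invariant_chain \<G>"
  shows "1 \<le> stability_index \<G>" "stable_from \<G> (stability_index \<G>)"
  using LeastI_ex[of "\<lambda>r. 1 \<le> r \<and> stable_from \<G> r"] chain_stabilizes[OF assms]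
  unfolding stability_index_def by auto

section \<open>Minimal paths as induced paths\<close>

lemma internal_vertices_map: "internal_vertices (map \<sigma> us) = \<sigma> ` internal_vertices us"
  unfolding internal_vertices_def by (simp flip: map_tl map_butlast)

lemma internal_vertices_subset: "internal_vertices us \<subseteq> set us"
  unfolding internal_vertices_def by (cases us) (auto dest: in_set_butlastD)

lemma internal_vertices_distinct:
  assumes "distinct us" "length us \<ge> 2"
  shows "internal_vertices us = set us - {hd us, last us}"
proof -
  obtain x vs y where us: "us = x # vs @ [y]"
    using assms(2) by (cases us; cases "tl us" rule: rev_cases) auto
  show ?thesis using assms(1) unfolding internal_vertices_def us by auto
qed

text \<open>Following a chord instead of the stretch of the path between its endpoints gives a path through a
  proper subset of the internal vertices.\<close>

lemma minimal_path_chordless: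
  assumes P: "minimal_path G us" and l: "k + 2 \<le> l" "l < length us"
  shows "{us ! k, us ! l} \<notin> edges G"
proof
  assume chord: "{us ! k, us ! l} \<in> edges G"
  have path: "is_path G us" and dist: "distinct us" using P unfolding minimal_path_def by auto
  define ws where "ws = take (Suc k) us @ drop l us"
  have len: "length ws = Suc k + (length us - l)" unfolding ws_def using l by simp
  have nth: "ws ! t = (if t \<le> k then us ! t else us ! (t + l - Suc k))" if "t < length ws" for t
    using that l unfolding ws_def by (auto simp: nth_append add.commute)
  have hd: "hd ws = hd us" unfolding ws_def using l by (cases us) auto
  have last: "last ws = last us" unfolding ws_def using l by simp
  have set: "set ws \<subseteq> set us"
    unfolding ws_def using set_take_subset[of "Suc k" us] set_drop_subset[of l us] by auto
  have "set (take (Suc k) us) \<inter> set (drop l us) = {}"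
    using set_take_disj_set_drop_if_distinct[OF dist, of "Suc k" l] l by auto
  then have dws: "distinct ws" unfolding ws_def using dist by auto
  have ws2: "length ws \<ge> 2" using len l by simp
  then obtain x vs y where ws: "ws = x # vs @ [y]"
    by (cases ws; cases "tl ws" rule: rev_cases) auto
  have "us ! Suc k \<notin> set ws"
  proof
    assume "us ! Suc k \<in> set ws"
    then obtain t where "t < length ws" "ws ! t = us ! Suc k" by (auto simp: in_set_conv_nth)
    then show False using nth[of t] len l dist
      by (auto simp: nth_eq_iff_index_eq split: if_splits)
  qed
  moreover have "us ! Suc k \<in> set us" using l by simp
  moreover have "us ! Suc k \<noteq> hd us" "us ! Suc k \<noteq> last us"
    using calculation(1) hd last ws2 by (metis hd_in_set last_in_set list.size(3) not_numeral_le_zero)+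
  ultimately have "internal_vertices ws \<subset> internal_vertices us"
    using internal_vertices_distinct[OF dws ws2] internal_vertices_distinct[OF dist] path set hd last
    unfolding is_path_def by auto
  then have "distinct vs" "set vs \<subset> internal_vertices us"
    using dws unfolding ws internal_vertices_def by auto
  then have "\<not> is_path G (hd us # vs @ [last us])" using P unfolding minimal_path_def by blast
  moreover have "hd us # vs @ [last us] = ws" using hd last ws by simp
  moreover have "is_path G ws"
    unfolding is_path_def
  proof (intro conjI allI impI)
    show "set ws \<subseteq> verts G" using path set unfolding is_path_def by auto
    fix t assume t: "Suc t < length ws"
    consider "t < k" | "t = k" | "k < t" by linarith
    then show "{ws ! t, ws ! Suc t} \<in> edges G"
    proof cases
      case 1
      then show ?thesis using t nth[of t] nth[of "Suc t"] path l unfolding is_path_def by auto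
    next
      case 2
      then show ?thesis using t nth[of t] nth[of "Suc t"] chord by simp
    next
      case 3
      then have "Suc t + l - Suc k = Suc (t + l - Suc k)" by simp
      moreover have "Suc (t + l - Suc k) < length us" using 3 t len by simp
      ultimately show ?thesis using 3 t nth[of t] nth[of "Suc t"] path unfolding is_path_def by simp
    qed
  qed (use ws2 in simp)
  ultimately show False by simp
qed

lemma minimal_path_induced:
  assumes "is_graph G" "minimal_path G us" "k < length us" "l < length us"
  shows "{us ! k, us ! l} \<in> edges G \<longleftrightarrow> l = Suc k \<or> k = Suc l"
proof -
  have step: "{us ! t, us ! Suc t} \<in> edges G" if "Suc t < length us" for t
    using assms(2) that unfolding minimal_path_def is_path_def by blast
  consider "l = k" | "l = Suc k" | "k = Suc l" | "k + 2 \<le> l" | "l + 2 \<le> k" by linarith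
  then show ?thesis
  proof cases
    case 1
    then show ?thesis using is_graph_edge(3)[OF assms(1), of "us ! k" "us ! k"] by auto
  next
    case 2
    then show ?thesis using step assms by auto
  next
    case 3
    then show ?thesis using step[of l] assms by (auto simp: insert_commute)
  next
    case 4
    then show ?thesis using minimal_path_chordless[OF assms(2) 4 assms(4)] by auto
  next
    case 5
    then show ?thesis
      using minimal_path_chordless[OF assms(2) 5 assms(3)] by (auto simp: insert_commute)
  qed
qed

lemma is_path_map_iff:
  assumes "set us \<subseteq> verts G" "\<sigma> ` set us \<subseteq> verts H"
    and "\<And>a b. a \<in> set us \<Longrightarrow> b \<in> set us \<Longrightarrow> {\<sigma> a, \<sigma> b} \<in> edges H \<longleftrightarrow> {a, b} \<in> edges G"
  shows "is_path H (map \<sigma> us) \<longleftrightarrow> is_path G us"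
  using assms unfolding is_path_def by auto

lemma minimal_path_map:
  assumes P: "minimal_path G us"
    and mono: "strict_mono_on (set us) \<sigma>" and verts: "\<sigma> ` set us \<subseteq> verts H"
    and edges: "\<And>a b. a \<in> set us \<Longrightarrow> b \<in> set us \<Longrightarrow> {\<sigma> a, \<sigma> b} \<in> edges H \<longleftrightarrow> {a, b} \<in> edges G"
  shows "minimal_path H (map \<sigma> us)"
proof -
  have path: "is_path G us" using P unfolding minimal_path_def by auto
  then have ne: "us \<noteq> []" and vG: "set us \<subseteq> verts G" unfolding is_path_def by auto
  have inj: "inj_on \<sigma> (set us)" using mono by (rule strict_mono_on_imp_inj_on)
  note int = internal_vertices_map[of \<sigma> us] and int_sub = internal_vertices_subset[of us]
  show ?thesis
    unfolding minimal_path_def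
  proof (intro conjI allI impI)
    show "is_path H (map \<sigma> us)" using is_path_map_iff[OF vG verts edges] path by simp
    show "hd (map \<sigma> us) < last (map \<sigma> us)"
      using P ne mono unfolding minimal_path_def
      by (simp add: hd_map last_map strict_mono_onD)
    show "distinct (map \<sigma> us)" using P inj unfolding minimal_path_def by (simp add: distinct_map)
    fix vs' assume vs': "distinct vs' \<and> set vs' \<subset> internal_vertices (map \<sigma> us)"
    then have "set vs' \<subseteq> \<sigma> ` internal_vertices us" using int by auto
    then have "vs' \<in> lists (\<sigma> ` internal_vertices us)" by auto
    then obtain vs where vs: "vs' = map \<sigma> vs" "set vs \<subseteq> internal_vertices us"
      by (auto simp: lists_image)
    have "set vs \<noteq> internal_vertices us" using vs' vs int by auto
    then have "\<not> is_path G (hd us # vs @ [last us])"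
      using P vs vs' unfolding minimal_path_def by (auto simp: distinct_map)
    moreover have "set (hd us # vs @ [last us]) \<subseteq> set us" using ne vs(2) int_sub by auto
    ultimately have "\<not> is_path H (map \<sigma> (hd us # vs @ [last us]))"
      using is_path_map_iff[of "hd us # vs @ [last us]" G \<sigma> H] vG verts edges
      by (meson image_mono order_trans subsetD)
    then show "\<not> is_path H (hd (map \<sigma> us) # vs' @ [last (map \<sigma> us)])"
      using ne vs(1) by (simp add: hd_map last_map)
  qed
qed

lemma admissible_path_map:
  assumes P: "admissible_path G us"
    and mono: "strict_mono_on (set us) \<sigma>" and verts: "\<sigma> ` set us \<subseteq> verts H"
    and edges: "\<And>a b. a \<in> set us \<Longrightarrow> b \<in> set us \<Longrightarrow> {\<sigma> a, \<sigma> b} \<in> edges H \<longleftrightarrow> {a, b} \<in> edges G"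
  shows "admissible_path H (map \<sigma> us)"
proof -
  have min: "minimal_path G us" using P unfolding admissible_path_def by auto
  then have ne: "us \<noteq> []" unfolding minimal_path_def is_path_def by auto
  note int = internal_vertices_map[of \<sigma> us] and int_sub = internal_vertices_subset[of us]
  have "\<sigma> w < \<sigma> (hd us) \<or> \<sigma> w > \<sigma> (last us)" if "w \<in> internal_vertices us" for w
    using that P int_sub ne mono unfolding admissible_path_def
    by (meson hd_in_set last_in_set strict_mono_onD subsetD)
  then show ?thesis
    unfolding admissible_path_def int
    using minimal_path_map[OF min mono verts edges] ne by (auto simp: hd_map last_map)
qed


section \<open>Induced paths split by a threshold\<close>

definition consecutive :: "nat \<Rightarrow> nat \<Rightarrow> bool" where
  "consecutive k l \<longleftrightarrow> l = Suc k \<or> k = Suc l"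

lemma consecutive_sym: "consecutive k l \<longleftrightarrow> consecutive l k"
  unfolding consecutive_def by auto

text \<open>An induced path with vertices \<open>p 0, \<dots>, p q\<close>, where adjacency of two vertices has become adjacency
  of their indices.  The assumptions say in which direction a neighbour may be moved on either side of
  \<open>s\<close>.  Positions are integers because negation then exchanges the two sides, so
  that each one-sided argument serves both.\<close>

locale split_sequence =
  fixes p :: "nat \<Rightarrow> int" and q :: nat and s :: int
  assumes distinct: "\<lbrakk>k \<le> q; l \<le> q; k \<noteq> l\<rbrakk> \<Longrightarrow> p k \<noteq> p l"
    and avoid: "k \<le> q \<Longrightarrow> p k \<noteq> s"
    and below: "\<lbrakk>k \<le> q; l \<le> q; m \<le> q; consecutive k l; p k < p l; p l \<le> p m; p m < s\<rbrakk>
      \<Longrightarrow> consecutive k m"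
    and above: "\<lbrakk>k \<le> q; l \<le> q; m \<le> q; consecutive k l; p k < p l; p m \<le> p k; s < p m\<rbrakk>
      \<Longrightarrow> consecutive m l"
    and across: "\<lbrakk>k \<le> q; l \<le> q; k' \<le> q; l' \<le> q; consecutive k l;
      p k \<le> p k'; p k' < s; s < p l'; p l' \<le> p l\<rbrakk> \<Longrightarrow> consecutive k' l'"
begin

lemma negate: "split_sequence (\<lambda>k. - p k) q (- s)"
proof
  show "- p k \<noteq> - p l" if "k \<le> q" "l \<le> q" "k \<noteq> l" for k l using distinct that by auto
  show "- p k \<noteq> - s" if "k \<le> q" for k using avoid that by auto
  show "consecutive k m" if "k \<le> q" "l \<le> q" "m \<le> q" "consecutive k l" "- p k < - p l"
    "- p l \<le> - p m" "- p m < - s" for k l m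
    using above[of l k m] that by (simp add: consecutive_sym)
  show "consecutive m l" if "k \<le> q" "l \<le> q" "m \<le> q" "consecutive k l" "- p k < - p l"
    "- p m \<le> - p k" "- s < - p m" for k l m
    using below[of l k m] that by (simp add: consecutive_sym)
  show "consecutive k' l'" if "k \<le> q" "l \<le> q" "k' \<le> q" "l' \<le> q" "consecutive k l"
    "- p k \<le> - p k'" "- p k' < - s" "- s < - p l'" "- p l' \<le> - p l" for k l k' l'
    using across[of l k l' k'] that by (simp add: consecutive_sym)
qed

lemma reverse: "split_sequence (\<lambda>k. p (q - k)) q s"
proof -
  have flip: "consecutive (q - k) (q - l) \<longleftrightarrow> consecutive k l" if "k \<le> q" "l \<le> q" for k l
    using that unfolding consecutive_def by auto
  show ?thesis
  proof
    show "p (q - k) \<noteq> p (q - l)" if "k \<le> q" "l \<le> q" "k \<noteq> l" for k l using that distinct by simp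
    show "p (q - k) \<noteq> s" if "k \<le> q" for k using avoid by simp
    show "consecutive k m" if "k \<le> q" "l \<le> q" "m \<le> q" "consecutive k l" "p (q - k) < p (q - l)"
      "p (q - l) \<le> p (q - m)" "p (q - m) < s" for k l m
      using below[of "q - k" "q - l" "q - m"] that by (simp add: flip)
    show "consecutive m l" if "k \<le> q" "l \<le> q" "m \<le> q" "consecutive k l" "p (q - k) < p (q - l)"
      "p (q - m) \<le> p (q - k)" "s < p (q - m)" for k l m
      using above[of "q - k" "q - l" "q - m"] that by (simp add: flip)
    show "consecutive k' l'" if "k \<le> q" "l \<le> q" "k' \<le> q" "l' \<le> q" "consecutive k l"
      "p (q - k) \<le> p (q - k')" "p (q - k') < s" "s < p (q - l')" "p (q - l') \<le> p (q - l)"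
      for k l k' l'
      using across[of "q - k" "q - l" "q - k'" "q - l'"] that by (simp add: flip)
  qed
qed

text \<open>Of two edges, the one with the smaller upper end can have that end moved up to the other upper end,
  so the lower end of one edge is adjacent to the upper end of the other.  The first and the
  last edge of an induced path with five vertices violate this.\<close>

lemma length_le_3_if_below:
  assumes "\<And>k. k \<le> q \<Longrightarrow> p k < s"
  shows "q \<le> 3"
proof (rule ccontr)
  assume "\<not> q \<le> 3"
  then have q: "4 \<le> q" by simp
  have link: "consecutive k l' \<or> consecutive k' l"
    if "k \<le> q" "l \<le> q" "k' \<le> q" "l' \<le> q" "consecutive k l" "consecutive k' l'"
      "p k < p l" "p k' < p l'" for k l k' l'
    using below[of k l l'] below[of k' l' l] assms that by (cases "p l \<le> p l'") auto
  have "p 0 < p 1 \<or> p 1 < p 0" "p 3 < p 4 \<or> p 4 < p 3"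
    using distinct[of 0 1] distinct[of 3 4] q by auto
  then show False
    using link[of 0 1 3 4] link[of 1 0 3 4] link[of 0 1 4 3] link[of 1 0 4 3] q
    by (auto simp: consecutive_def)
qed

end

text \<open>Here \<open>x\<close> and \<open>y\<close> index the two vertices nearest to the threshold, one on each side.  Among the vertices
  on its side each has the most neighbours across.\<close>

locale split_pair = split_sequence +
  fixes x y :: nat
  assumes x: "x \<le> q" "p x < s" "\<And>k. \<lbrakk>k \<le> q; p k < s\<rbrakk> \<Longrightarrow> p k \<le> p x"
    and y: "y \<le> q" "s < p y" "\<And>k. \<lbrakk>k \<le> q; s < p k\<rbrakk> \<Longrightarrow> p y \<le> p k"
    and xy: "consecutive x y"
begin

lemma negate_pair: "split_pair (\<lambda>k. - p k) q (- s) y x"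
  using negate x y xy unfolding split_pair_def split_pair_axioms_def by (auto simp: consecutive_sym)

lemma reverse_pair: "split_pair (\<lambda>k. p (q - k)) q s (q - x) (q - y)"
  using reverse x y xy unfolding split_pair_def split_pair_axioms_def
  by (auto simp: consecutive_def)

text \<open>A vertex below \<open>s\<close> that is adjacent to neither \<open>x\<close> nor \<open>y\<close> has no neighbour across, since this
  neighbour could be moved to \<open>y\<close>, and no larger neighbour below, since this could be moved to \<open>x\<close>.  A smaller
  neighbour is adjacent to \<open>x\<close>, by moving the vertex itself.\<close>

lemma neighbour_below:
  assumes "z \<le> q" "w \<le> q" "p z < s" "\<not> consecutive z x" "\<not> consecutive z y" "consecutive z w"
  shows "p w < s \<and> consecutive w x"
proof -
  have w: "p w < s"
    using avoid[of w] across[of z w z y] y assms by (cases "s < p w") auto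
  have "p z \<noteq> p w" using distinct[of z w] assms by (auto simp: consecutive_def)
  moreover have "\<not> p z < p w" using below[of z w x] x w assms by blast
  ultimately have "p w < p z" by simp
  then show ?thesis using below[of w z x] x w assms by (simp add: consecutive_sym)
qed

lemma neighbour_above:
  assumes "z \<le> q" "w \<le> q" "s < p z" "\<not> consecutive z x" "\<not> consecutive z y" "consecutive z w"
  shows "s < p w \<and> consecutive w y"
  using split_pair.neighbour_below[OF negate_pair, of z w] assms by simp

lemma remote_independent:
  assumes "z \<le> q" "w \<le> q" "\<not> consecutive z x" "\<not> consecutive z y"
    and "\<not> consecutive w x" "\<not> consecutive w y"
  shows "\<not> consecutive z w"
  using neighbour_below[of z w] neighbour_above[of z w] avoid[of z] assms by linarith

text \<open>As the vertices adjacent to neither \<open>x\<close> nor \<open>y\<close> are pairwise non-adjacent, the path extends at most two steps beyond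
  this edge in either direction.\<close>

lemma length_le_5: "q \<le> 5"
proof -
  define m where "m = min x y"
  have m: "x = m \<and> y = Suc m \<or> x = Suc m \<and> y = m"
    using xy unfolding m_def consecutive_def by auto
  have "m \<le> 2"
  proof (rule ccontr)
    assume "\<not> m \<le> 2"
    then obtain t where "m = t + 3" by (intro that[of "m - 3"]) simp
    then show False using remote_independent[of t "Suc t"] m x(1) y(1)
      by (auto simp: consecutive_def)
  qed
  moreover have "q \<le> m + 3"
  proof (rule ccontr)
    assume "\<not> q \<le> m + 3"
    then show False using remote_independent[of "m + 3" "m + 4"] m by (auto simp: consecutive_def)
  qed
  ultimately show ?thesis by simp
qed

text \<open>The vertex \<open>p y\<close> lies above \<open>s\<close>, hence is internal.  If \<open>q \<ge> 4\<close>, then \<open>neighbour_below\<close> applied to the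
  two ends shows that \<open>q = 4\<close> and \<open>x = 2\<close>.  The last vertex is adjacent to \<open>y\<close> and the first two are not, so
  both are smaller than the last; as \<open>p 1\<close> lies outside the range of the ends, it is smaller than
  \<open>p 0\<close>, and the edge from \<open>p 1\<close> to \<open>p 0\<close> can be moved to a chord from \<open>p 1\<close> to \<open>p 4\<close>.\<close>

lemma length_le_3_if_ends_below_forward:
  assumes ends: "p 0 < s" "p q < s" and y_next: "y = Suc x"
    and outside: "\<And>k. \<lbrakk>0 < k; k < q\<rbrakk> \<Longrightarrow> p k < min (p 0) (p q) \<or> max (p 0) (p q) < p k"
  shows "q \<le> 3"
proof (rule ccontr)
  assume "\<not> q \<le> 3"
  then have q: "4 \<le> q" by simp
  have "y \<noteq> q" using ends y by auto
  then have "Suc x < q" using y y_next by simp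
  moreover have "\<not> x + 3 \<le> q"
    using neighbour_below[of q "q - 1"] ends y_next by (auto simp: consecutive_def)
  ultimately have x_eq: "q = x + 2" by simp
  then have "x = 2 \<and> p 1 < s"
    using neighbour_below[of 0 1] ends y_next q by (auto simp: consecutive_def)
  then have eqs: "x = 2" "y = 3" "q = 4" "p 1 < s" using x_eq y_next by auto
  have "p 0 < p 4"
    using across[of 4 3 0 3] eqs ends y by (fastforce simp: consecutive_def)
  moreover have "p 1 < p 4"
    using across[of 4 3 1 3] eqs ends y by (fastforce simp: consecutive_def)
  ultimately have "p 1 < p 0" using outside[of 1] eqs by auto
  then show False using below[of 1 0 4] \<open>p 0 < p 4\<close> eqs ends by (auto simp: consecutive_def)
qed

lemma length_le_3_if_ends_below:
  assumes ends: "p 0 < s" "p q < s"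
    and outside: "\<And>k. \<lbrakk>0 < k; k < q\<rbrakk> \<Longrightarrow> p k < min (p 0) (p q) \<or> max (p 0) (p q) < p k"
  shows "q \<le> 3"
proof (cases "y = Suc x")
  case True
  then show ?thesis using length_le_3_if_ends_below_forward[OF ends] outside by blast
next
  case False
  then have "q - y = Suc (q - x)" using xy x(1) by (auto simp: consecutive_def)
  moreover have "p (q - k) < min (p q) (p 0) \<or> max (p q) (p 0) < p (q - k)" if "0 < k" "k < q" for k
    using outside[of "q - k"] that by (auto simp: min.commute max.commute)
  ultimately show ?thesis
    using split_pair.length_le_3_if_ends_below_forward[OF reverse_pair] ends by simp
qed

text \<open>Both \<open>p x\<close> and \<open>p y\<close> lie in the range of the ends, so they are the ends.\<close>

lemma length_le_3_if_ends_split: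
  assumes ends: "p 0 < s" "s < p q"
    and outside: "\<And>k. \<lbrakk>0 < k; k < q\<rbrakk> \<Longrightarrow> p k < min (p 0) (p q) \<or> max (p 0) (p q) < p k"
  shows "q \<le> 3"
proof -
  have "x \<noteq> q" using x(2) ends(2) by auto
  moreover have "y \<noteq> 0" using y(2) ends(1) by (metis less_asym)
  moreover have "\<not> (0 < x \<and> x < q)" using outside[of x] x ends by fastforce
  moreover have "\<not> (0 < y \<and> y < q)" using outside[of y] y ends by fastforce
  ultimately have "x = 0" "y = q" using x y by auto
  then show ?thesis using xy by (auto simp: consecutive_def)
qed

lemma length_le_3:
  assumes outside: "\<And>k. \<lbrakk>0 < k; k < q\<rbrakk> \<Longrightarrow> p k < min (p 0) (p q) \<or> max (p 0) (p q) < p k"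
  shows "q \<le> 3"
proof -
  have neg: "- p k < min (- p 0) (- p q) \<or> max (- p 0) (- p q) < - p k" if "0 < k" "k < q" for k
    using outside[OF that] by linarith
  consider "p 0 < s" "p q < s" | "p 0 < s" "s < p q" | "s < p 0" "p q < s" | "s < p 0" "s < p q"
    using avoid[of 0] avoid[of q] by linarith
  then show ?thesis
  proof cases
    case 1
    then show ?thesis using length_le_3_if_ends_below outside by blast
  next
    case 2
    then show ?thesis using length_le_3_if_ends_split outside by blast
  next
    case 3
    then show ?thesis
      using split_pair.length_le_3_if_ends_split[OF negate_pair] neg by simp
  next
    case 4
    then show ?thesis
      using split_pair.length_le_3_if_ends_below[OF negate_pair] neg by simp
  qed
qed

end

context split_sequence
begin

text \<open>A path that visits both sides crosses the threshold somewhere, and a crossing edge can be moved to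
  the two extremal vertices.\<close>

lemma both_sides_pair:
  assumes "\<exists>k\<le>q. p k < s" "\<exists>k\<le>q. s < p k"
  obtains x y where "split_pair p q s x y"
proof -
  let ?A = "{k. k \<le> q \<and> p k < s}" and ?B = "{k. k \<le> q \<and> s < p k}"
  have fin: "finite ?A" "finite ?B" by auto
  have "Max (p ` ?A) \<in> p ` ?A" using assms(1) fin by (intro Max_in) auto
  then obtain x where x: "x \<in> ?A" "Max (p ` ?A) = p x" by blast
  have x_max: "p k \<le> p x" if "k \<in> ?A" for k
    using Max_ge[OF finite_imageI[OF fin(1)] imageI[OF that]] x(2) by metis
  have "Min (p ` ?B) \<in> p ` ?B" using assms(2) fin by (intro Min_in) auto
  then obtain y where y: "y \<in> ?B" "Min (p ` ?B) = p y" by blast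
  have y_min: "p y \<le> p k" if "k \<in> ?B" for k
    using Min_le[OF finite_imageI[OF fin(2)] imageI[OF that]] y(2) by metis
  have "\<exists>t<q. (p t < s) \<noteq> (p (Suc t) < s)"
  proof (rule ccontr)
    assume "\<not> (\<exists>t<q. (p t < s) \<noteq> (p (Suc t) < s))"
    then have "t \<le> q \<longrightarrow> (p t < s) = (p 0 < s)" for t by (induction t) auto
    then show False using assms by (meson less_asym)
  qed
  then obtain t where t: "t < q" "(p t < s) \<noteq> (p (Suc t) < s)" by blast
  then have "\<exists>k l. k \<le> q \<and> l \<le> q \<and> consecutive k l \<and> p k < s \<and> s < p l"
    using avoid[of t] avoid[of "Suc t"] unfolding consecutive_def
    by (metis Suc_leI less_imp_le_nat linorder_neqE)
  then obtain k l where "k \<le> q" "l \<le> q" "consecutive k l" "p k < s" "s < p l" by blast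
  then have "consecutive x y" using across[of k l x y] x(1) y(1) x_max y_min by simp
  then have "split_pair p q s x y"
    using x(1) y(1) x_max y_min by unfold_locales auto
  then show ?thesis by (rule that)
qed

theorem length_bounds:
  shows "q \<le> 5"
    and "(\<And>k. \<lbrakk>0 < k; k < q\<rbrakk> \<Longrightarrow> p k < min (p 0) (p q) \<or> max (p 0) (p q) < p k) \<Longrightarrow> q \<le> 3"
proof -
  have "q \<le> 3 \<or> (\<exists>x y. split_pair p q s x y)"
  proof (cases "\<exists>k\<le>q. p k < s")
    case True
    show ?thesis
    proof (cases "\<exists>k\<le>q. s < p k")
      case True
      then show ?thesis using both_sides_pair \<open>\<exists>k\<le>q. p k < s\<close> by metis
    next
      case False
      then have "p k < s" if "k \<le> q" for k using avoid[OF that] that by (meson linorder_neqE)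
      then show ?thesis using length_le_3_if_below by blast
    qed
  next
    case False
    then have "- p k < - s" if "k \<le> q" for k using avoid[OF that] that by (meson linorder_neqE neg_less_iff_less)
    then show ?thesis using split_sequence.length_le_3_if_below[OF negate] by blast
  qed
  then show "q \<le> 5" using split_pair.length_le_5 by fastforce
  assume "\<And>k. \<lbrakk>0 < k; k < q\<rbrakk> \<Longrightarrow> p k < min (p 0) (p q) \<or> max (p 0) (p q) < p k"
  with \<open>q \<le> 3 \<or> (\<exists>x y. split_pair p q s x y)\<close> show "q \<le> 3"
    using split_pair.length_le_3 by blast
qed

end

section \<open>Graphs spread from a pattern\<close>

text \<open>The set \<open>T\<close> plays the role of the edges \<open>i < j\<close> of \<open>G\<^sub>r\<close>.\<close>

locale edge_pattern =
  fixes T :: "(nat \<times> nat) set" and r :: nat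
  assumes pattern_range: "(i, j) \<in> T \<Longrightarrow> 1 \<le> i \<and> i < j \<and> j \<le> r"
    and starts_at_1: "\<exists>i. (1, i) \<in> T"
    and ends_at_r: "\<exists>j. (j, r) \<in> T"
begin

text \<open>The three conditions are \<open>i \<le> a\<close>, \<open>j - i \<le> b - a\<close> and \<open>r - j \<le> n - b\<close>, without truncated
  subtraction.\<close>

definition spread :: "nat \<Rightarrow> nat \<Rightarrow> nat \<Rightarrow> bool" where
  "spread n a b \<longleftrightarrow> (\<exists>(i, j)\<in>T. i \<le> a \<and> j + a \<le> b + i \<and> b + r \<le> n + j)"

definition adjacent :: "nat \<Rightarrow> nat \<Rightarrow> nat \<Rightarrow> bool" where
  "adjacent n a b \<longleftrightarrow> spread n a b \<or> spread n b a"

definition induced_path :: "nat \<Rightarrow> (nat \<Rightarrow> nat) \<Rightarrow> nat \<Rightarrow> bool" where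
  "induced_path n u q \<longleftrightarrow> (\<forall>k\<le>q. 1 \<le> u k \<and> u k \<le> n) \<and> inj_on u {..q} \<and>
     (\<forall>k\<le>q. \<forall>l\<le>q. adjacent n (u k) (u l) \<longleftrightarrow> consecutive k l)"

text \<open>The window consists of the numbers strictly between \<open>s\<close> and \<open>s + r\<close>.  With \<open>s = 0\<close> or \<open>s + r = n\<close> all
  vertices may lie on one side.\<close>

definition empty_window :: "nat \<Rightarrow> nat set \<Rightarrow> nat \<Rightarrow> bool" where
  "empty_window n V s \<longleftrightarrow> s + r \<le> n \<and> (\<forall>v\<in>V. v \<le> s \<or> s + r \<le> v)"

lemma r_ge_2: "2 \<le> r"
  using starts_at_1 pattern_range by fastforce

lemma spread_less: "spread n a b \<Longrightarrow> a < b"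
  unfolding spread_def using pattern_range by fastforce

lemma adjacent_commute: "adjacent n a b \<longleftrightarrow> adjacent n b a"
  unfolding adjacent_def by auto

lemma far_adjacent_left:
  assumes "1 \<le> a" "a + r \<le> b" "b + r \<le> n"
  shows "adjacent n a b"
proof -
  obtain i where "(1, i) \<in> T" using starts_at_1 by blast
  then show ?thesis
    unfolding adjacent_def spread_def using pattern_range[of 1 i] assms by force
qed

lemma far_adjacent_right:
  assumes "r \<le> a" "a + r \<le> b" "b \<le> n"
  shows "adjacent n a b"
proof -
  obtain j where "(j, r) \<in> T" using ends_at_r by blast
  then show ?thesis
    unfolding adjacent_def spread_def using pattern_range[of j r] assms by force
qed

lemma no_empty_window_vertex:
  fixes u :: "nat \<Rightarrow> nat" and q :: nat
  assumes "\<not> (\<exists>s. empty_window n (u ` {..q}) s)" "s + r \<le> n"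
  shows "\<exists>k\<le>q. s < u k \<and> u k < s + r"
proof -
  have "\<not> empty_window n (u ` {..q}) s" using assms(1) by blast
  then show ?thesis using assms(2) unfolding empty_window_def by (auto simp: not_le)
qed

text \<open>The windows at \<open>0, r, 2r, 3r, 4r\<close> are pairwise disjoint.\<close>

lemma empty_window_few_vertices:
  fixes u :: "nat \<Rightarrow> nat" and q :: nat
  assumes n: "5 * r \<le> n" and q: "q \<le> 3"
  shows "\<exists>s. empty_window n (u ` {..q}) s"
proof (rule ccontr)
  assume none: "\<not> ?thesis"
  have "t \<in> (\<lambda>k. u k div r) ` {..q}" if "t < 5" for t
  proof -
    have "Suc t * r \<le> 5 * r" using that by (intro mult_le_mono1) simp
    then have "t * r + r \<le> n" using n unfolding mult_Suc by linarith
    then obtain k where "k \<le> q" "t * r < u k" "u k < t * r + r"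
      using no_empty_window_vertex[OF none] by blast
    then have "u k div r = t" by (intro div_nat_eqI) (auto simp: algebra_simps)
    then show ?thesis using \<open>k \<le> q\<close> by force
  qed
  then have "{..<5} \<subseteq> (\<lambda>k. u k div r) ` {..q}" by blast
  then have "card {..<5::nat} \<le> card ((\<lambda>k. u k div r) ` {..q})"
    by (rule card_mono[OF finite_imageI[OF finite_atMost]])
  also have "\<dots> \<le> card {..q}" by (rule card_image_le[OF finite_atMost])
  finally have "card {..<5::nat} \<le> card {..q}" .
  then show False using q by simp
qed

text \<open>Otherwise the path has a vertex \<open>a\<close> near the left end, a vertex \<open>b\<close> near the right end and a vertex
  \<open>c\<close> in the window at \<open>2r\<close>.  Then \<open>c\<close> is adjacent to \<open>a\<close> and \<open>b\<close>, and every other vertex,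
  being non-adjacent to \<open>c\<close>, is close to \<open>c\<close> and hence adjacent to exactly one of \<open>a\<close> and \<open>b\<close>.  So there are five
  vertices in all, and the first and the last of them are both greater than \<open>r\<close> and more than \<open>r\<close> apart, hence
  adjacent, which closes the path to a cycle.\<close>

lemma empty_window_many_vertices:
  assumes n: "5 * r \<le> n" and q: "4 \<le> q" and P: "induced_path n u q"
  shows "\<exists>s. empty_window n (u ` {..q}) s"
proof (rule ccontr)
  assume none: "\<not> ?thesis"
  note hit = no_empty_window_vertex[OF none]
  have range: "1 \<le> u k" "u k \<le> n" if "k \<le> q" for k
    using P that unfolding induced_path_def by auto
  have adj: "adjacent n (u k) (u l) \<longleftrightarrow> consecutive k l" if "k \<le> q" "l \<le> q" for k l
    using P that unfolding induced_path_def by auto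
  obtain a where a: "a \<le> q" "u a < r" using hit[of 0] n by auto
  obtain b where b: "b \<le> q" "n - r < u b" using hit[of "n - r"] n by auto
  obtain c where c: "c \<le> q" "2 * r < u c" "u c < 3 * r" using hit[of "2 * r"] n by auto
  have ac: "consecutive a c"
    using far_adjacent_left[of "u a" "u c" n] adj[of a c] range[of a] a c n by simp
  have cb: "consecutive c b"
    using far_adjacent_right[of "u c" "u b" n] adj[of c b] range[of b] b c n by simp
  have "a \<noteq> b" using a b n by auto
  then have abc: "a = c - 1 \<and> b = c + 1 \<and> 1 \<le> c \<or> a = c + 1 \<and> b = c - 1 \<and> 1 \<le> c"
    using ac cb unfolding consecutive_def by auto
  have other: "consecutive d a \<and> \<not> consecutive d b \<and> 3 * r < u d \<or>
      consecutive d b \<and> \<not> consecutive d a \<and> r < u d \<and> u d < 2 * r"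
    if d: "d \<le> q" "d \<noteq> a" "d \<noteq> b" "d \<noteq> c" for d
  proof -
    have dc: "\<not> consecutive d c" using abc d unfolding consecutive_def by auto
    have not_both: "\<not> (consecutive d a \<and> consecutive d b)"
      using abc d unfolding consecutive_def by auto
    have near: "r < u d" "u d < 4 * r"
      using far_adjacent_left[of "u d" "u c" n] far_adjacent_right[of "u c" "u d" n]
        adj[of d c] adj[of c d] consecutive_sym[of c d] range[of d] dc c d n by linarith+
    have "consecutive d a" if "2 * r \<le> u d"
      using far_adjacent_left[of "u a" "u d" n] adj[of a d] consecutive_sym[of a d]
        range[of a] near a d n that by auto
    moreover have "consecutive d b" if "u d \<le> 3 * r"
      using far_adjacent_right[of "u d" "u b" n] adj[of d b]
        range[of b] near b d n that by auto
    ultimately show ?thesis using not_both near by linarith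
  qed
  have two: "x = c - 2 \<and> 2 \<le> c \<or> x = c + 2" if "x \<le> q" "x \<noteq> a" "x \<noteq> b" "x \<noteq> c" for x
    using other[OF that] that abc unfolding consecutive_def by auto
  \<comment> \<open>Every index is within distance two of \<open>c\<close>, in particular \<open>0\<close> and \<open>q\<close>.\<close>
  have "c \<le> 2" using two[of 0] abc by (cases "c \<le> 1") auto
  moreover have "q = a \<or> q = b \<or> q = c \<or> q = c - 2 \<or> q = c + 2" using two[of q] by blast
  then have "q \<le> c + 2" using abc by auto
  ultimately have c2: "c = 2" "q = 4" using q by auto
  have "r < u 0 \<and> u 0 < 2 * r \<and> 3 * r < u 4 \<or> r < u 4 \<and> u 4 < 2 * r \<and> 3 * r < u 0"
    using other[of 0] other[of 4] abc c2 by (auto simp: consecutive_def)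
  then have "adjacent n (u 0) (u 4)"
    using far_adjacent_right[of "u 0" "u 4" n] far_adjacent_right[of "u 4" "u 0" n]
      adjacent_commute range[of 0] range[of 4] c2 by auto
  then show False using adj[of 0 4] c2 by (auto simp: consecutive_def)
qed

lemma empty_window_exists:
  assumes "5 * r \<le> n" "induced_path n u q"
  shows "\<exists>s. empty_window n (u ` {..q}) s"
  using empty_window_few_vertices empty_window_many_vertices assms
  by (cases "q \<le> 3") auto

text \<open>A neighbour is moved by reusing the element of \<open>T\<close> that witnesses the given edge: of its three
  bounds, the move preserves those that the edge satisfies and the window guarantees the rest.\<close>

lemma split_at_empty_window:
  assumes P: "induced_path n u q" and win: "empty_window n (u ` {..q}) s"
  shows "split_sequence (\<lambda>k. int (u k)) q (int s + 1)"
proof -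
  have s: "s + r \<le> n" and sides: "\<And>k. k \<le> q \<Longrightarrow> u k \<le> s \<or> s + r \<le> u k"
    using win unfolding empty_window_def by auto
  have inj: "inj_on u {..q}"
    and adj: "\<And>k l. \<lbrakk>k \<le> q; l \<le> q\<rbrakk> \<Longrightarrow> adjacent n (u k) (u l) \<longleftrightarrow> consecutive k l"
    using P unfolding induced_path_def by auto
  have spread_pair: "spread n (u k) (u l)" if "k \<le> q" "l \<le> q" "consecutive k l" "u k < u l" for k l
    using adj[of k l] that spread_less[of n "u l" "u k"] unfolding adjacent_def by auto
  have consec: "consecutive k l" if "k \<le> q" "l \<le> q" "spread n (u k) (u l)" for k l
    using adj[of k l] that unfolding adjacent_def by auto
  show ?thesis
  proof
    show "int (u k) \<noteq> int (u l)" if "k \<le> q" "l \<le> q" "k \<noteq> l" for k l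
      using inj that by (auto dest: inj_onD)
    \<comment> \<open>The threshold \<open>s + 1\<close> lies inside the window, as \<open>r \<ge> 2\<close>.\<close>
    show "int (u k) \<noteq> int s + 1" if "k \<le> q" for k
      using sides[OF that] r_ge_2 by linarith
    show "consecutive k m" if "k \<le> q" "l \<le> q" "m \<le> q" "consecutive k l"
      "int (u k) < int (u l)" "int (u l) \<le> int (u m)" "int (u m) < int s + 1" for k l m
    proof (rule consec)
      have "spread n (u k) (u l)" using spread_pair that by simp
      then obtain i j where "(i, j) \<in> T" "i \<le> u k" "j + u k \<le> u l + i" unfolding spread_def by auto
      then show "spread n (u k) (u m)" unfolding spread_def
        using that s by (intro bexI[of _ "(i, j)"]) auto
    qed (use that in auto)
    show "consecutive m l" if "k \<le> q" "l \<le> q" "m \<le> q" "consecutive k l"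
      "int (u k) < int (u l)" "int (u m) \<le> int (u k)" "int s + 1 < int (u m)" for k l m
    proof (rule consec)
      have "spread n (u k) (u l)" using spread_pair that by simp
      then obtain i j where "(i, j) \<in> T" "j + u k \<le> u l + i" "u l + r \<le> n + j"
        unfolding spread_def by auto
      then show "spread n (u m) (u l)" unfolding spread_def
        using that sides[of m] pattern_range[of i j] by (intro bexI[of _ "(i, j)"]) auto
    qed (use that in auto)
    show "consecutive k' l'" if "k \<le> q" "l \<le> q" "k' \<le> q" "l' \<le> q" "consecutive k l"
      "int (u k) \<le> int (u k')" "int (u k') < int s + 1" "int s + 1 < int (u l')"
      "int (u l') \<le> int (u l)" for k l k' l'
    proof (rule consec)
      have "spread n (u k) (u l)" using spread_pair that by simp
      then obtain i j where "(i, j) \<in> T" "i \<le> u k" "u l + r \<le> n + j" unfolding spread_def by auto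
      then show "spread n (u k') (u l')" unfolding spread_def
        using that sides[of l'] pattern_range[of i j] by (intro bexI[of _ "(i, j)"]) auto
    qed (use that in auto)
  qed
qed

text \<open>For a pair on one side of the window, all bounds but one keep both sides unchanged or both increased
  by one; the remaining bound, and for a pair across the window the distance bound, hold before and
  after because of the width of the window.\<close>

lemma spread_shift_iff:
  assumes s: "s + r \<le> n + 1" and a: "a \<le> s \<or> s + r \<le> a + 1" and b: "b \<le> s \<or> s + r \<le> b + 1"
  defines "\<sigma> \<equiv> \<lambda>v. if v \<le> s then v else v + 1"
  shows "spread (n + 1) (\<sigma> a) (\<sigma> b) \<longleftrightarrow> spread n a b"
proof (cases "a < b")
  case True
  have "(i \<le> \<sigma> a \<and> j + \<sigma> a \<le> \<sigma> b + i \<and> \<sigma> b + r \<le> (n + 1) + j) \<longleftrightarrow>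
      (i \<le> a \<and> j + a \<le> b + i \<and> b + r \<le> n + j)" if "(i, j) \<in> T" for i j
    using pattern_range[OF that] s a b True unfolding \<sigma>_def by auto
  then show ?thesis unfolding spread_def by (intro bex_cong) auto
next
  case False
  then have "\<not> \<sigma> a < \<sigma> b" unfolding \<sigma>_def by auto
  then show ?thesis using False spread_less by blast
qed

lemma adjacent_shift_iff:
  assumes "s + r \<le> n + 1" "a \<le> s \<or> s + r \<le> a + 1" "b \<le> s \<or> s + r \<le> b + 1"
  shows "adjacent (n + 1) (if a \<le> s then a else a + 1) (if b \<le> s then b else b + 1) \<longleftrightarrow>
    adjacent n a b"
  using spread_shift_iff[OF assms] spread_shift_iff[OF assms(1,3,2)] unfolding adjacent_def by simp

end

section \<open>Path lengths in a stable chain\<close>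

text \<open>This turns membership in \<open>Inc_upto r m\<close> into inequalities and identifies the edges of a stable chain with
  the spread of the edges of \<open>G\<^sub>r\<close>.\<close>

lemma stable_chain_edge_iff:
  assumes stable: "graph_image (Inc_upto r m) G = H" and G: "is_graph G" "verts G \<subseteq> {1..r}"
    and ab: "a < b"
  shows "{a, b} \<in> edges H \<longleftrightarrow>
    (\<exists>i j. i < j \<and> {i, j} \<in> edges G \<and> i \<le> a \<and> j + a \<le> b + i \<and> b + r \<le> m + j)"
proof
  assume "{a, b} \<in> edges H"
  then obtain \<pi> i j where \<pi>: "{a, b} = {\<pi> i, \<pi> j}" "\<pi> \<in> Inc_upto r m" "{i, j} \<in> edges G"
    using stable unfolding graph_image_def by auto
  have "\<exists>i j. i < j \<and> {i, j} \<in> edges G \<and> {a, b} = {\<pi> i, \<pi> j}"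
  proof (cases "i < j")
    case True
    then show ?thesis using \<pi> by blast
  next
    case False
    then have "j < i" using is_graph_edge(3)[OF G(1) \<pi>(3)] by simp
    then show ?thesis using \<pi> by (intro exI[of _ j] exI[of _ i]) (auto simp: insert_commute)
  qed
  then obtain i j where ij: "i < j" "{i, j} \<in> edges G" "{a, b} = {\<pi> i, \<pi> j}" by blast
  have "1 \<le> i" "j \<le> r" using is_graph_edge[OF G(1) ij(2)] G(2) by auto
  then have "i \<le> \<pi> i" "\<pi> i + j \<le> \<pi> j + i" "\<pi> j + r \<le> \<pi> r + j" "\<pi> r \<le> m"
    using Inc_expands[of \<pi>] \<pi>(2) ij(1) unfolding Inc_upto_def by auto
  moreover from this have "a = \<pi> i" "b = \<pi> j" using ij ab by (auto simp: doubleton_eq_iff)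
  ultimately show "\<exists>i j. i < j \<and> {i, j} \<in> edges G \<and> i \<le> a \<and> j + a \<le> b + i \<and> b + r \<le> m + j"
    using ij by (intro exI[of _ i] exI[of _ j]) auto
next
  assume "\<exists>i j. i < j \<and> {i, j} \<in> edges G \<and> i \<le> a \<and> j + a \<le> b + i \<and> b + r \<le> m + j"
  then obtain i j where ij: "i < j" "{i, j} \<in> edges G" "i \<le> a" "j + a \<le> b + i" "b + r \<le> m + j"
    by blast
  have "1 \<le> i" "j \<le> r" using is_graph_edge[OF G(1) ij(2)] G(2) by auto
  then obtain \<pi> where "\<pi> \<in> Inc_upto r m" "\<pi> i = a" "\<pi> j = b"
    using Inc_upto_map_exists[of i j r a b m] ij by (metis less_imp_le_nat less_irrefl)
  then have "{a, b} \<in> edges (graph_image (Inc_upto r m) G)"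
    unfolding graph_image_def using ij(2) by (simp only: ugraph.simps) blast
  then show "{a, b} \<in> edges H" unfolding stable .
qed

lemma stable_chain_verts:
  assumes stable: "graph_image (Inc_upto r m) G = H" and G: "verts G = {1..r}"
    and r: "1 \<le> r" "r \<le> m" and H: "verts H \<subseteq> {1..m}"
  shows "verts H = {1..m}"
proof
  show "{1..m} \<subseteq> verts H"
  proof
    fix v assume v: "v \<in> {1..m}"
    define i where "i = min v r"
    have "1 \<le> i" "i \<le> r" "i \<le> v" "v + r \<le> m + i" using v r unfolding i_def by auto
    then obtain \<pi> where "\<pi> \<in> Inc_upto r m" "\<pi> i = v"
      using Inc_upto_map_exists[of i i r v v m] by auto
    then show "v \<in> verts H" using stable G \<open>1 \<le> i\<close> \<open>i \<le> r\<close> unfolding graph_image_def by force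
  qed
qed (fact H)

lemma Max_nat_le:
  fixes A :: "nat set"
  assumes "A \<noteq> {}" "\<And>x. x \<in> A \<Longrightarrow> x \<le> c"
  shows "Max A \<le> c"
proof -
  have "finite A" using assms(2) by (auto simp: finite_nat_set_iff_bounded_le)
  then show ?thesis using assms by (intro Max.boundedI)
qed

locale spread_chain = edge_pattern +
  fixes \<G> :: "nat \<Rightarrow> ugraph"
  assumes graph: "r \<le> n \<Longrightarrow> is_graph (\<G> n)"
    and verts: "r \<le> n \<Longrightarrow> verts (\<G> n) = {1..n}"
    and edge_iff: "r \<le> n \<Longrightarrow> {a, b} \<in> edges (\<G> n) \<longleftrightarrow> adjacent n a b"
begin

lemma minimal_path_induced_path:
  assumes n: "r \<le> n" and P: "minimal_path (\<G> n) us"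
  shows "induced_path n (\<lambda>k. us ! k) (path_length us)"
proof -
  have path: "is_path (\<G> n) us" and dist: "distinct us" using P unfolding minimal_path_def by auto
  then have len: "k \<le> path_length us \<longleftrightarrow> k < length us" for k
    unfolding is_path_def path_length_def by auto
  have "us ! k \<in> {1..n}" if "k < length us" for k
    using path verts[OF n] nth_mem[OF that] unfolding is_path_def by auto
  moreover have "inj_on (\<lambda>k. us ! k) {..path_length us}"
    using dist len by (auto simp: inj_on_def nth_eq_iff_index_eq)
  moreover have "adjacent n (us ! k) (us ! l) \<longleftrightarrow> consecutive k l"
    if "k < length us" "l < length us" for k l
    using minimal_path_induced[OF graph[OF n] P that] edge_iff[OF n] unfolding consecutive_def by simp
  ultimately show ?thesis unfolding induced_path_def len by auto
qed

lemma set_conv_nth_path_length: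
  assumes "minimal_path G us"
  shows "set us = (\<lambda>k. us ! k) ` {..path_length us}"
  using assms unfolding minimal_path_def is_path_def path_length_def set_conv_nth by fastforce

lemma minimal_path_empty_window:
  assumes n: "5 * r \<le> n" and P: "minimal_path (\<G> n) us"
  obtains s where "empty_window n (set us) s"
  using empty_window_exists[OF n minimal_path_induced_path[OF _ P]] n
    set_conv_nth_path_length[OF P] by auto

lemma minimal_path_length_le_5:
  assumes n: "5 * r \<le> n" and P: "minimal_path (\<G> n) us"
  shows "path_length us \<le> 5"
proof -
  have ind: "induced_path n (\<lambda>k. us ! k) (path_length us)"
    using minimal_path_induced_path[OF _ P] n by simp
  then obtain s where "empty_window n ((\<lambda>k. us ! k) ` {..path_length us}) s"
    using empty_window_exists[OF n] by blast
  then show ?thesis using split_sequence.length_bounds(1)[OF split_at_empty_window[OF ind]] by blast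
qed

lemma admissible_path_length_le_3:
  assumes n: "5 * r \<le> n" and A: "admissible_path (\<G> n) us"
  shows "path_length us \<le> 3"
proof -
  have P: "minimal_path (\<G> n) us" using A unfolding admissible_path_def by simp
  have ind: "induced_path n (\<lambda>k. us ! k) (path_length us)"
    using minimal_path_induced_path[OF _ P] n by simp
  then obtain s where win: "empty_window n ((\<lambda>k. us ! k) ` {..path_length us}) s"
    using empty_window_exists[OF n] by blast
  have len: "length us = Suc (path_length us)" "us \<noteq> []" and dist: "distinct us"
    using P unfolding minimal_path_def is_path_def path_length_def by auto
  have ends: "hd us = us ! 0" "last us = us ! path_length us" "us ! 0 < us ! path_length us"
    using P len unfolding minimal_path_def by (auto simp: hd_conv_nth last_conv_nth)
  show ?thesis
  proof (rule split_sequence.length_bounds(2)[OF split_at_empty_window[OF ind win]])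
    fix k assume k: "0 < k" "k < path_length us"
    then have "us ! k \<in> internal_vertices us"
      using internal_vertices_distinct[OF dist] len ends(1,2) dist by (auto simp: nth_eq_iff_index_eq)
    then have "us ! k < us ! 0 \<or> us ! path_length us < us ! k"
      using A ends unfolding admissible_path_def by auto
    then show "int (us ! k) < min (int (us ! 0)) (int (us ! path_length us)) \<or>
        max (int (us ! 0)) (int (us ! path_length us)) < int (us ! k)"
      using ends(3) by auto
  qed
qed

lemma transport_up:
  assumes n: "r \<le> n" and win: "empty_window n V s" and V: "V \<subseteq> {1..n}"
  obtains \<sigma> where "strict_mono_on V \<sigma>" "\<sigma> ` V \<subseteq> verts (\<G> (n + 1))"
    "\<And>a b. a \<in> V \<Longrightarrow> b \<in> V \<Longrightarrow> {\<sigma> a, \<sigma> b} \<in> edges (\<G> (n + 1)) \<longleftrightarrow> {a, b} \<in> edges (\<G> n)"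
proof
  let ?\<sigma> = "\<lambda>v. if v \<le> s then v else v + 1"
  show "strict_mono_on V ?\<sigma>" by (auto intro!: strict_mono_onI)
  show "?\<sigma> ` V \<subseteq> verts (\<G> (n + 1))" using V n verts[of "n + 1"] by auto
  fix a b assume "a \<in> V" "b \<in> V"
  then have "s + r \<le> n + 1" "a \<le> s \<or> s + r \<le> a + 1" "b \<le> s \<or> s + r \<le> b + 1"
    using win unfolding empty_window_def by fastforce+
  from adjacent_shift_iff[OF this]
  show "{?\<sigma> a, ?\<sigma> b} \<in> edges (\<G> (n + 1)) \<longleftrightarrow> {a, b} \<in> edges (\<G> n)"
    using n edge_iff[of n] edge_iff[of "n + 1"] by simp
qed

lemma transport_down:
  assumes n: "r \<le> n" and win: "empty_window (n + 1) V s" and V: "V \<subseteq> {1..n + 1}"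
  obtains \<sigma> where "strict_mono_on V \<sigma>" "\<sigma> ` V \<subseteq> verts (\<G> n)"
    "\<And>a b. a \<in> V \<Longrightarrow> b \<in> V \<Longrightarrow> {\<sigma> a, \<sigma> b} \<in> edges (\<G> n) \<longleftrightarrow> {a, b} \<in> edges (\<G> (n + 1))"
proof
  let ?\<sigma> = "\<lambda>v. if v \<le> s then v else v - 1"
  have s: "s + r \<le> n + 1" and sides: "\<And>v. v \<in> V \<Longrightarrow> v \<le> s \<or> s + r \<le> v"
    using win unfolding empty_window_def by auto
  have pre: "?\<sigma> v \<le> s \<or> s + r \<le> ?\<sigma> v + 1" "(if ?\<sigma> v \<le> s then ?\<sigma> v else ?\<sigma> v + 1) = v"
    "1 \<le> ?\<sigma> v" "?\<sigma> v \<le> n" if "v \<in> V" for v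
    using sides[OF that] r_ge_2 V that s by auto
  show "strict_mono_on V ?\<sigma>"
  proof (rule strict_mono_onI)
    fix a b assume "a \<in> V" "b \<in> V" "a < b"
    then show "?\<sigma> a < ?\<sigma> b" using sides[of a] sides[of b] r_ge_2 by auto
  qed
  show "?\<sigma> ` V \<subseteq> verts (\<G> n)"
    unfolding verts[OF n] using pre(3,4) by (intro image_subsetI) (simp only: atLeastAtMost_iff)
  fix a b assume ab: "a \<in> V" "b \<in> V"
  have "adjacent (n + 1) a b \<longleftrightarrow> adjacent n (?\<sigma> a) (?\<sigma> b)"
    using adjacent_shift_iff[OF s pre(1)[OF ab(1)] pre(1)[OF ab(2)]]
    unfolding pre(2)[OF ab(1)] pre(2)[OF ab(2)] .
  then show "{?\<sigma> a, ?\<sigma> b} \<in> edges (\<G> n) \<longleftrightarrow> {a, b} \<in> edges (\<G> (n + 1))"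
    using n edge_iff[of n] edge_iff[of "n + 1"] by simp
qed

text \<open>The window of a path allows stretching from \<open>n\<close> to \<open>n + 1\<close> and shrinking from \<open>n + 1\<close> to \<open>n\<close>; the order is
  preserved, so admissibility is too.\<close>

lemma transport_paths:
  assumes n: "5 * r \<le> n" and m: "m = n + 1 \<and> k = n \<or> m = n \<and> k = n + 1"
    and P: "minimal_path (\<G> k) us"
  obtains vs where "minimal_path (\<G> m) vs" "path_length vs = path_length us"
    "admissible_path (\<G> k) us \<Longrightarrow> admissible_path (\<G> m) vs"
proof -
  have rn: "r \<le> n" using n by simp
  have "5 * r \<le> k" using n m by auto
  then obtain s where win: "empty_window k (set us) s"
    by (rule minimal_path_empty_window[OF _ P]) (rule that)
  have V: "set us \<subseteq> {1..k}"
    using P verts[of k] rn m unfolding minimal_path_def is_path_def by auto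
  obtain \<sigma> where \<sigma>: "strict_mono_on (set us) \<sigma>" "\<sigma> ` set us \<subseteq> verts (\<G> m)"
    "\<And>a b. a \<in> set us \<Longrightarrow> b \<in> set us \<Longrightarrow> {\<sigma> a, \<sigma> b} \<in> edges (\<G> m) \<longleftrightarrow> {a, b} \<in> edges (\<G> k)"
  proof (cases "k = n")
    case True
    then have k: "k = n" "m = n + 1" using m by auto
    show thesis
      by (rule transport_up[OF rn win[unfolded k] V[unfolded k]]) (rule that[unfolded k])
  next
    case False
    then have k: "k = n + 1" "m = n" using m by auto
    show thesis
      by (rule transport_down[OF rn win[unfolded k] V[unfolded k]]) (rule that[unfolded k])
  qed
  show ?thesis
    using that[of "map \<sigma> us"] minimal_path_map[OF P \<sigma>] admissible_path_map[OF _ \<sigma>]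
    by (simp add: path_length_def)
qed

lemma minimal_lengths_eq:
  assumes "5 * r \<le> n"
  shows "{path_length us | us. minimal_path (\<G> n) us} =
    {path_length us | us. minimal_path (\<G> (n + 1)) us}"
proof (intro equalityI subsetI)
  fix q assume "q \<in> {path_length us | us. minimal_path (\<G> n) us}"
  then obtain us where us: "minimal_path (\<G> n) us" "q = path_length us" by blast
  obtain vs where "minimal_path (\<G> (n + 1)) vs" "path_length vs = path_length us"
    by (rule transport_paths[OF assms _ us(1), of "n + 1"]) auto
  then show "q \<in> {path_length us | us. minimal_path (\<G> (n + 1)) us}" using us(2) by (intro CollectI exI[of _ vs]) simp
next
  fix q assume "q \<in> {path_length us | us. minimal_path (\<G> (n + 1)) us}"
  then obtain us where us: "minimal_path (\<G> (n + 1)) us" "q = path_length us" by blast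
  obtain vs where "minimal_path (\<G> n) vs" "path_length vs = path_length us"
    by (rule transport_paths[OF assms _ us(1), of n]) auto
  then show "q \<in> {path_length us | us. minimal_path (\<G> n) us}" using us(2) by (intro CollectI exI[of _ vs]) simp
qed

lemma admissible_lengths_eq:
  assumes "5 * r \<le> n"
  shows "{path_length us | us. admissible_path (\<G> n) us} =
    {path_length us | us. admissible_path (\<G> (n + 1)) us}"
proof (intro equalityI subsetI)
  fix q assume "q \<in> {path_length us | us. admissible_path (\<G> n) us}"
  then obtain us where us: "admissible_path (\<G> n) us" "q = path_length us" by blast
  then have P: "minimal_path (\<G> n) us" unfolding admissible_path_def by simp
  obtain vs where "admissible_path (\<G> (n + 1)) vs" "path_length vs = path_length us"
    by (rule transport_paths[OF assms _ P, of "n + 1"]) (use us in auto)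
  then show "q \<in> {path_length us | us. admissible_path (\<G> (n + 1)) us}" using us(2) by (intro CollectI exI[of _ vs]) simp
next
  fix q assume "q \<in> {path_length us | us. admissible_path (\<G> (n + 1)) us}"
  then obtain us where us: "admissible_path (\<G> (n + 1)) us" "q = path_length us" by blast
  then have P: "minimal_path (\<G> (n + 1)) us" unfolding admissible_path_def by simp
  obtain vs where "admissible_path (\<G> n) vs" "path_length vs = path_length us"
    by (rule transport_paths[OF assms _ P, of n]) (use us in auto)
  then show "q \<in> {path_length us | us. admissible_path (\<G> n) us}" using us(2) by (intro CollectI exI[of _ vs]) simp
qed

lemma max_lengths_eq_next:
  assumes "5 * r \<le> n"
  shows "max_admissible_length (\<G> n) = max_admissible_length (\<G> (n + 1))"
    and "max_minimal_length (\<G> n) = max_minimal_length (\<G> (n + 1))"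
  unfolding max_admissible_length_def max_minimal_length_def
  by (simp_all only: admissible_lengths_eq[OF assms] minimal_lengths_eq[OF assms])

text \<open>Needed for the maxima: \<open>Max\<close> of the empty set is unspecified.\<close>

lemma admissible_path_exists:
  assumes "5 * r \<le> n"
  shows "\<exists>us. admissible_path (\<G> n) us"
proof
  have "adjacent n 1 (r + 1)" using far_adjacent_left[of 1 "r + 1" n] assms r_ge_2 by simp
  then have "{1, r + 1} \<in> edges (\<G> n)" using edge_iff[of n] assms by simp
  moreover have "{1, r + 1} \<subseteq> verts (\<G> n)" using verts[of n] assms r_ge_2 by simp
  ultimately show "admissible_path (\<G> n) [1, r + 1]"
    using r_ge_2
    unfolding admissible_path_def minimal_path_def is_path_def internal_vertices_def by simp
qed

lemma max_lengths_le:
  assumes n: "5 * r \<le> n"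
  shows "max_admissible_length (\<G> n) \<le> 3" "max_minimal_length (\<G> n) \<le> 5"
proof -
  obtain us where us: "admissible_path (\<G> n) us" using admissible_path_exists[OF n] by blast
  then have "minimal_path (\<G> n) us" unfolding admissible_path_def by simp
  show "max_admissible_length (\<G> n) \<le> 3"
    unfolding max_admissible_length_def
  proof (rule Max_nat_le)
    show "{path_length us | us. admissible_path (\<G> n) us} \<noteq> {}" using us by blast
  qed (elim CollectE exE conjE, simp add: admissible_path_length_le_3[OF n])
  show "max_minimal_length (\<G> n) \<le> 5"
    unfolding max_minimal_length_def
  proof (rule Max_nat_le)
    show "{path_length us | us. minimal_path (\<G> n) us} \<noteq> {}"
      using \<open>minimal_path (\<G> n) us\<close> by blast
  qed (elim CollectE exE conjE, simp add: minimal_path_length_le_5[OF n])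
qed

end

theorem theorem8p3:
  fixes \<G> :: "nat \<Rightarrow> ugraph" and r i j :: nat
  assumes "inc_invariant_chain \<G>"
    and "stability_index \<G> = r"
    and "verts (\<G> r) = {1..r}"
    and "i \<in> {1..r}" and "j \<in> {1..r}"
    and "{1, i} \<in> edges (\<G> r)" and "{j, r} \<in> edges (\<G> r)"
  shows "(\<forall>n\<ge>5 * r. max_admissible_length (\<G> n) \<le> 3 \<and> max_minimal_length (\<G> n) \<le> 5) \<and>
         (\<forall>n\<ge>5 * r + 9. max_admissible_length (\<G> n) = max_admissible_length (\<G> (n + 1)) \<and>
                         max_minimal_length (\<G> n) = max_minimal_length (\<G> (n + 1)))"
proof -
  have r: "1 \<le> r" and stable: "stable_from \<G> r"
    using stable_from_stability_index[OF assms(1)] assms(2) by auto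
  have graph: "is_graph (\<G> n)" "verts (\<G> n) \<subseteq> {1..n}" if "1 \<le> n" for n
    using assms(1) that unfolding inc_invariant_chain_def by auto
  have image: "graph_image (Inc_upto r n) (\<G> r) = \<G> n" if "r \<le> n" for n
    using stable that unfolding stable_from_def by simp
  define T where "T = {(i, j). i < j \<and> {i, j} \<in> edges (\<G> r)}"
  interpret edge_pattern T r
  proof
    show "1 \<le> i \<and> i < j \<and> j \<le> r" if "(i, j) \<in> T" for i j
      using is_graph_edge[OF graph(1)[OF r], of i j] graph(2)[OF r] that unfolding T_def by auto
    have "1 < i" using is_graph_edge(3)[OF graph(1)[OF r] assms(6)] assms(4) by auto
    then show "\<exists>i. (1, i) \<in> T" using assms(6) unfolding T_def by auto
    have "j < r" using is_graph_edge(3)[OF graph(1)[OF r] assms(7)] assms(5) by auto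
    then show "\<exists>j. (j, r) \<in> T" using assms(7) unfolding T_def by auto
  qed
  interpret spread_chain T r \<G>
  proof
    fix n assume n: "r \<le> n"
    then have n1: "1 \<le> n" using r by simp
    show "is_graph (\<G> n)" using graph(1)[OF n1] .
    show "verts (\<G> n) = {1..n}"
      using stable_chain_verts[OF image[OF n] assms(3) r n graph(2)[OF n1]] .
    have less: "{a, b} \<in> edges (\<G> n) \<longleftrightarrow> adjacent n a b" if "a < b" for a b
    proof -
      have "(\<exists>(i, j)\<in>T. P i j) \<longleftrightarrow> (\<exists>i j. i < j \<and> {i, j} \<in> edges (\<G> r) \<and> P i j)" for P
        unfolding T_def by auto
      then have "spread n a b \<longleftrightarrow> {a, b} \<in> edges (\<G> n)"
        unfolding spread_def stable_chain_edge_iff[OF image[OF n] graph[OF r] that] .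
      moreover have "\<not> spread n b a" using spread_less that by (meson less_asym)
      ultimately show ?thesis unfolding adjacent_def by blast
    qed
    fix a b :: nat
    consider "a < b" | "b < a" | "a = b" by linarith
    then show "{a, b} \<in> edges (\<G> n) \<longleftrightarrow> adjacent n a b"
    proof cases
      case 1
      then show ?thesis by (rule less)
    next
      case 2
      then show ?thesis using less[of b a] adjacent_commute by (simp add: insert_commute)
    next
      case 3
      then show ?thesis
        using is_graph_edge(3)[OF graph(1)[OF n1], of a b] spread_less unfolding adjacent_def by blast
    qed
  qed
  show ?thesis
  proof (intro conjI allI impI)
    fix n assume "5 * r \<le> n"
    then show "max_admissible_length (\<G> n) \<le> 3" "max_minimal_length (\<G> n) \<le> 5"
      by (rule max_lengths_le)+
  next
    fix n assume "5 * r + 9 \<le> n"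
    then have "5 * r \<le> n" by simp
    then show "max_admissible_length (\<G> n) = max_admissible_length (\<G> (n + 1))"
      "max_minimal_length (\<G> n) = max_minimal_length (\<G> (n + 1))"
      by (rule max_lengths_eq_next)+
  qed
qed

end
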